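(* Let $(P,\preceq)$ be a locally finite lattice and let $f:P\to\mathbb{C}$ be semimultiplicative with $f(x)\neq0$ for all $x\in P$. Let $S=\{x_1,\dots,x_n\}\subseteq P$ be upper-closed up to $\vee S$, indexed so that $x_i\preceq x_j\Rightarrow i\le j$. Then $$\det(S)_f=\prod_{v=1}^n f(x_v)^2\Psi_{S,1/f}(x_v)=\prod_{v=1}^n f(x_v)^2\sum_{x_u\in S,\ x_v\preceq x_u}\frac{\mu(x_v,x_u)}{f(x_u)}.$$
   Context: $f$ is semimultiplicative if $f(x)f(y)=f(x\wedge y)f(x\vee y)$ for all $x,y\in P$. $\vee S=x_1\vee\cdots\vee x_n$; $S$ is upper-closed up to $\vee S$ if $x\in S$ whenever $y\in S$, $y\preceq x$ and $x\preceq\vee S$. $(S)_f$ is the $n\times n$ matrix with $(i,j)$ entry $f(x_i\wedge x_j)$. $\Psi_{S,1/f}$ is defined on $S$ recursively by $\Psi_{S,1/f}(x_k)=1/f(x_k)-\sum_{x_v\in S,\ x_k\prec x_v}\Psi_{S,1/f}(x_v)$. $\mu$ is the Möbius function of $(P,\preceq)$. *)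

theory Defs
  imports Complex_Main "Jordan_Normal_Form.Determinant"
begin

class locally_finite_order = order +
  assumes finite_interval: "finite {a..b}"

function mobius :: "'a::locally_finite_order \<Rightarrow> 'a \<Rightarrow> int" where
  "mobius a b =
     (if a = b then 1
      else if a < b then - (\<Sum>c\<in>{a..<b}. mobius a c)
      else 0)"
  by pat_completeness auto
termination
proof (relation "measure (\<lambda>(a, b). card {a..b})")
  fix a b c :: 'a
  assume "c \<in> {a..<b}"
  then have "{a..c} \<subset> {a..b}"
    by (auto simp: psubset_eq set_eq_iff intro: order_trans exI[of _ b])
  then show "((a, c), (a, b)) \<in> measure (\<lambda>(a, b). card {a..b})"
    by (simp add: finite_interval psubset_card_mono)
qed simp

declare mobius.simps [simp del]

definition semimultiplicative :: "('a::lattice \<Rightarrow> complex) \<Rightarrow> bool" where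
  "semimultiplicative f \<longleftrightarrow> (\<forall>a b. f a * f b = f (inf a b) * f (sup a b))"

definition upper_closed_up_to_join :: "'a::lattice set \<Rightarrow> bool" where
  "upper_closed_up_to_join S \<longleftrightarrow>
     (\<forall>a b. b \<in> S \<and> b \<le> a \<and> a \<le> \<Squnion>\<^sub>f\<^sub>i\<^sub>n S \<longrightarrow> a \<in> S)"

definition meet_matrix :: "nat \<Rightarrow> (nat \<Rightarrow> 'a::lattice) \<Rightarrow> ('a \<Rightarrow> complex) \<Rightarrow> complex mat" where
  "meet_matrix n x f = mat n n (\<lambda>(i, j). f (inf (x i) (x j)))"

text \<open>The recursion terminates only for finite \<open>S\<close>, whence the guard; values outside \<open>S\<close> are
  irrelevant.\<close>

function Psi :: "'a::order set \<Rightarrow> ('a \<Rightarrow> complex) \<Rightarrow> 'a \<Rightarrow> complex" where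
  "Psi S g a = (if finite S then g a - (\<Sum>b\<in>{b \<in> S. a < b}. Psi S g b) else 0)"
  by pat_completeness auto
termination
proof (relation "measure (\<lambda>(S, g, a). card {b \<in> S. a < b})")
  fix S :: "'a set" and g :: "'a \<Rightarrow> complex" and a b :: 'a
  assume "finite S" and "b \<in> {b \<in> S. a < b}"
  then have "{c \<in> S. b < c} \<subset> {c \<in> S. a < c}"
    by (auto intro: less_trans)
  then show "((S, g, b), (S, g, a)) \<in> measure (\<lambda>(S, g, a). card {b \<in> S. a < b})"
    using \<open>finite S\<close> by (simp add: psubset_card_mono)
qed simp

declare Psi.simps [simp del]

end

theory Submission imports Defs
begin

text \<open>Semimultiplicativity turns the entry \<open>f (x\<^sub>i \<sqinter> x\<^sub>j)\<close> into \<open>f x\<^sub>i * f x\<^sub>j / f (x\<^sub>i \<squnion> x\<^sub>j)\<close>.  The join lies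
  in \<open>S\<close>, so the recursion for \<open>\<Psi>\<close> expands its reciprocal value as the sum of \<open>\<Psi> u\<close> over the common
  upper bounds \<open>u \<in> S\<close> of \<open>x\<^sub>i\<close> and \<open>x\<^sub>j\<close>.  Hence the meet matrix is \<open>U D U\<^sup>T\<close> with \<open>D\<close> the diagonal matrix of
  the \<open>\<Psi> x\<^sub>v\<close> and \<open>U\<close> upper triangular with diagonal entries \<open>f x\<^sub>v\<close>.  The second formula is dual Moebius
  inversion: every interval with end points in \<open>S\<close> is contained in \<open>S\<close>.\<close>

lemma sum_mobius_interval:
  fixes a b :: "'a::locally_finite_order"
  assumes "a \<le> b"
  shows "(\<Sum>c\<in>{a..b}. mobius a c) = (if a = b then 1 else 0)"
proof (cases "a = b")
  case True
  then show ?thesis by (simp add: mobius.simps)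
next
  case False
  with assms have "a < b" by simp
  then have "{a..b} = insert b {a..<b}" by auto
  moreover have "finite {a..<b}"
    by (rule finite_subset[OF _ finite_interval[of a b]]) auto
  ultimately have "(\<Sum>c\<in>{a..b}. mobius a c) = mobius a b + (\<Sum>c\<in>{a..<b}. mobius a c)"
    by simp
  also have "\<dots> = 0"
    using \<open>a < b\<close> by (simp add: mobius.simps[of a b])
  finally show ?thesis using False by simp
qed

text \<open>Moving the sum over strictly larger elements to the other side of the recursion for
  \<open>Psi\<close> leaves \<open>g a\<close>. Thus \<open>Psi\<close> is the inverse of summation
  over upper sets in \<open>S\<close>, for every \<open>g\<close>.\<close>

lemma sum_Psi_upper:
  assumes "finite S" and "a \<in> S"
  shows "(\<Sum>b\<in>{b \<in> S. a \<le> b}. Psi S g b) = g a"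
proof -
  have "{b \<in> S. a \<le> b} = insert a {b \<in> S. a < b}"
    using assms by auto
  then have "(\<Sum>b\<in>{b \<in> S. a \<le> b}. Psi S g b) = Psi S g a + (\<Sum>b\<in>{b \<in> S. a < b}. Psi S g b)"
    using assms by simp
  also have "\<dots> = g a"
    using assms by (subst Psi.simps) simp
  finally show ?thesis .
qed

text \<open>Expand each \<open>g u\<close> as an upper sum of \<open>Psi\<close> and exchange the
  sums: the coefficient of \<open>Psi S g w\<close> is then a sum of \<open>mobius a u\<close> over
  the \<open>u\<close> between \<open>a\<close> and \<open>w\<close>, which vanishes unless
  \<open>w = a\<close>.\<close>

lemma Psi_eq_sum_mobius:
  fixes S :: "'a::locally_finite_order set"
  assumes fin: "finite S" and a: "a \<in> S"
    and convex: "\<And>b c. b \<in> S \<Longrightarrow> a \<le> c \<Longrightarrow> c \<le> b \<Longrightarrow> c \<in> S"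
  shows "Psi S g a = (\<Sum>u\<in>{u \<in> S. a \<le> u}. of_int (mobius a u) * g u)"
proof -
  let ?T = "{u \<in> S. a \<le> u}"
  have finT: "finite ?T" using fin by simp
  have "(\<Sum>u\<in>?T. of_int (mobius a u) * g u)
      = (\<Sum>u\<in>?T. \<Sum>w\<in>{w \<in> ?T. u \<le> w}. of_int (mobius a u) * Psi S g w)"
  proof (rule sum.cong[OF refl])
    fix u assume u: "u \<in> ?T"
    then have "{w \<in> ?T. u \<le> w} = {w \<in> S. u \<le> w}" by auto
    then show "of_int (mobius a u) * g u
        = (\<Sum>w\<in>{w \<in> ?T. u \<le> w}. of_int (mobius a u) * Psi S g w)"
      using sum_Psi_upper[OF fin, of u g] u by (simp flip: sum_distrib_left)
  qed
  also have "\<dots> = (\<Sum>w\<in>?T. \<Sum>u\<in>{u \<in> ?T. u \<le> w}. of_int (mobius a u) * Psi S g w)"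
    by (rule sum.swap_restrict[OF finT finT])
  also have "\<dots> = (\<Sum>w\<in>?T. if w = a then Psi S g w else 0)"
  proof (rule sum.cong[OF refl])
    fix w assume w: "w \<in> ?T"
    \<comment> \<open>\<open>mobius\<close> belongs to the whole order, not to \<open>S\<close>, so
      its values are summed over the full interval; \<open>convex\<close> ensures that no element of
      it is missing from \<open>S\<close>.\<close>
    then have "{u \<in> ?T. u \<le> w} = {a..w}" using convex by auto
    then have "(\<Sum>u\<in>{u \<in> ?T. u \<le> w}. of_int (mobius a u) * Psi S g w)
        = of_int (\<Sum>u\<in>{a..w}. mobius a u) * Psi S g w"
      by (simp add: sum_distrib_right)
    also have "\<dots> = (if w = a then Psi S g w else 0)"
      using w by (auto simp: sum_mobius_interval)
    finally show "(\<Sum>u\<in>{u \<in> ?T. u \<le> w}. of_int (mobius a u) * Psi S g w)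
        = (if w = a then Psi S g w else 0)" .
  qed
  also have "\<dots> = Psi S g a"
    using finT a by simp
  finally show ?thesis by simp
qed

lemma det_mat_upper_triangular:
  fixes h :: "nat \<Rightarrow> nat \<Rightarrow> 'a::comm_ring_1"
  assumes "\<And>i j. i < n \<Longrightarrow> j < i \<Longrightarrow> h i j = 0"
  shows "det (mat n n (\<lambda>(i, j). h i j)) = (\<Prod>v<n. h v v)"
proof -
  let ?A = "mat n n (\<lambda>(i, j). h i j)"
  have "upper_triangular ?A"
    using assms by (auto intro!: upper_triangularI)
  then have "det ?A = prod_list (diag_mat ?A)"
    by (rule det_upper_triangular[where n = n]) simp
  also have "\<dots> = (\<Prod>v<n. h v v)"
    by (simp add: prod_list_diag_prod atLeast0LessThan)
  finally show ?thesis .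
qed

lemma upper_closed_sup_mem:
  assumes "finite S" "upper_closed_up_to_join S" "a \<in> S" "b \<in> S"
  shows "sup a b \<in> S"
proof -
  have "sup a b \<le> \<Squnion>\<^sub>f\<^sub>i\<^sub>n S"
    using assms by (simp add: Sup_fin.coboundedI)
  then show ?thesis
    using assms unfolding upper_closed_up_to_join_def by (meson sup_ge1)
qed

lemma upper_closed_between_mem:
  assumes "finite S" "upper_closed_up_to_join S" "a \<in> S" "b \<in> S" "a \<le> c" "c \<le> b"
  shows "c \<in> S"
proof -
  have "c \<le> \<Squnion>\<^sub>f\<^sub>i\<^sub>n S"
    using assms by (meson Sup_fin.coboundedI order_trans)
  then show ?thesis
    using assms unfolding upper_closed_up_to_join_def by blast
qed

lemma semimultiplicative_inf_eq_sum_Psi: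
  fixes f :: "'a::lattice \<Rightarrow> complex"
  assumes "semimultiplicative f" and "f (sup a b) \<noteq> 0"
    and "finite S" and "sup a b \<in> S"
  shows "f (inf a b) = f a * f b * (\<Sum>u\<in>{u \<in> S. a \<le> u \<and> b \<le> u}. Psi S (\<lambda>c. 1 / f c) u)"
proof -
  have "f (inf a b) = f a * f b * (1 / f (sup a b))"
    using assms(1,2) by (simp add: semimultiplicative_def field_simps)
  \<comment> \<open>The elements above \<open>sup a b\<close> are exactly the common upper bounds of
    \<open>a\<close> and \<open>b\<close>.\<close>
  then show ?thesis
    using sum_Psi_upper[OF assms(3,4), of "\<lambda>c. 1 / f c"] by simp
qed

lemma det_meet_matrix:
  fixes f :: "'a::lattice \<Rightarrow> complex"
  assumes semi: "semimultiplicative f" and nz: "\<And>a. f a \<noteq> 0"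
    and S: "S = x ` {..<n}" and upper: "upper_closed_up_to_join S"
    and ord: "\<And>i j. i < n \<Longrightarrow> j < n \<Longrightarrow> x i \<le> x j \<Longrightarrow> i \<le> j"
  shows "det (meet_matrix n x f) = (\<Prod>v<n. (f (x v))\<^sup>2 * Psi S (\<lambda>a. 1 / f a) (x v))"
proof -
  let ?P = "\<lambda>v. Psi S (\<lambda>a. 1 / f a) (x v)"
  \<comment> \<open>\<open>V\<close> is the product \<open>U D\<close>: absorbing the diagonal
    matrix into the left factor leaves a product of two triangular matrices.\<close>
  define U where "U = mat n n (\<lambda>(i, v). if x i \<le> x v then f (x i) else 0)"
  define V where "V = mat n n (\<lambda>(i, v). if x i \<le> x v then f (x i) * ?P v else 0)"
  have fin: "finite S" using S by simp
  \<comment> \<open>Equal values are comparable in both directions, so \<open>ord\<close> forces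
    equal indices. Sums over \<open>S\<close> thereby become sums over indices.\<close>
  have inj: "inj_on x {..<n}"
    using ord by (metis antisym inj_onI lessThan_iff order_refl)
  have below: "\<not> x i \<le> x j" if "i < n" "j < i" for i j
    using ord[of i j] that by auto
  have entry: "f (inf (x i) (x j))
      = (\<Sum>v<n. (if x i \<le> x v then f (x i) * ?P v else 0) * (if x j \<le> x v then f (x j) else 0))"
    if "i < n" "j < n" for i j
  proof -
    have ij: "x i \<in> S" "x j \<in> S" using that S by auto
    have "f (inf (x i) (x j))
        = f (x i) * f (x j) * (\<Sum>u\<in>{u \<in> S. x i \<le> u \<and> x j \<le> u}. Psi S (\<lambda>c. 1 / f c) u)"
      by (rule semimultiplicative_inf_eq_sum_Psi[OF semi nz fin upper_closed_sup_mem[OF fin upper ij]])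
    \<comment> \<open>The condition moves into the summand so that the index set is all of
      \<open>S\<close> and can be reindexed along \<open>x\<close>.\<close>
    also have "\<dots> = f (x i) * f (x j)
        * (\<Sum>u\<in>S. if x i \<le> u \<and> x j \<le> u then Psi S (\<lambda>c. 1 / f c) u else 0)"
      using fin by (simp add: sum.inter_filter)
    also have "\<dots> = f (x i) * f (x j) * (\<Sum>v<n. if x i \<le> x v \<and> x j \<le> x v then ?P v else 0)"
      \<comment> \<open>Only the index set is unfolded; the \<open>S\<close> inside
        \<open>Psi\<close> stays.\<close>
      by (subst (1) S, subst sum.reindex[OF inj]) (simp add: o_def)
    also have "\<dots> = (\<Sum>v<n. (if x i \<le> x v then f (x i) * ?P v else 0)
        * (if x j \<le> x v then f (x j) else 0))"
      by (auto simp: sum_distrib_left intro!: sum.cong)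
    finally show ?thesis .
  qed
  have "meet_matrix n x f = V * transpose_mat U"
    by (rule eq_matI)
      (auto simp: meet_matrix_def U_def V_def entry scalar_prod_def atLeast0LessThan intro!: sum.cong)
  then have "det (meet_matrix n x f) = det V * det U"
    by (simp add: det_mult[where n = n] det_transpose[where n = n] U_def V_def)
  also have "det U = (\<Prod>v<n. f (x v))"
    unfolding U_def by (subst det_mat_upper_triangular) (simp_all add: below)
  also have "det V = (\<Prod>v<n. f (x v) * ?P v)"
    unfolding V_def by (subst det_mat_upper_triangular) (simp_all add: below)
  finally show ?thesis
    by (simp add: power2_eq_square ac_simps flip: prod.distrib)
qed

theorem theorem6p5:
  fixes f :: "'a::{lattice, locally_finite_order} \<Rightarrow> complex"
    and x :: "nat \<Rightarrow> 'a" and n :: nat and S :: "'a set"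
  assumes "semimultiplicative f"
    and "\<And>a. f a \<noteq> 0"
    and "n \<ge> 1"
    and "S = x ` {..<n}"
    and "upper_closed_up_to_join S"
    and "\<And>i j. i < n \<Longrightarrow> j < n \<Longrightarrow> x i \<le> x j \<Longrightarrow> i \<le> j"
  shows "det (meet_matrix n x f) = (\<Prod>v<n. (f (x v))\<^sup>2 * Psi S (\<lambda>a. 1 / f a) (x v))
    \<and> (\<Prod>v<n. (f (x v))\<^sup>2 * Psi S (\<lambda>a. 1 / f a) (x v))
      = (\<Prod>v<n. (f (x v))\<^sup>2 * (\<Sum>u\<in>{u \<in> S. x v \<le> u}. of_int (mobius (x v) u) / f u))"
proof (intro conjI prod.cong refl)
  show "det (meet_matrix n x f) = (\<Prod>v<n. (f (x v))\<^sup>2 * Psi S (\<lambda>a. 1 / f a) (x v))"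
    using assms(1,2,4-6) by (rule det_meet_matrix)
next
  \<comment> \<open>The two products agree factor by factor, by inversion at \<open>x v\<close> with
    \<open>1 / f\<close> in place of \<open>g\<close>.\<close>
  fix v assume "v \<in> {..<n}"
  then have v: "x v \<in> S" and fin: "finite S" using assms(4) by auto
  have "Psi S (\<lambda>a. 1 / f a) (x v) = (\<Sum>u\<in>{u \<in> S. x v \<le> u}. of_int (mobius (x v) u) * (1 / f u))"
    by (rule Psi_eq_sum_mobius[OF fin v]) (rule upper_closed_between_mem[OF fin assms(5) v])
  then show "(f (x v))\<^sup>2 * Psi S (\<lambda>a. 1 / f a) (x v)
      = (f (x v))\<^sup>2 * (\<Sum>u\<in>{u \<in> S. x v \<le> u}. of_int (mobius (x v) u) / f u)"
    by simp
qed

end
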